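(* Let $\Delta ABC$ be a triangle with side lengths $a\leq b\leq c$. Then any triangle $\Delta A_1B_1C_1$ with side lengths $a_1\leq b_1\leq c_1$ is similar to $\Delta ABC$ if and only if there exists a real number $k>0$ such that $a=ka_1$, $b=kb_1$ and $c=kc_1$, where these products are geometric products.
   Context: Two triangles are called similar if they have the same angles. Work in the Euclidean plane (with Euclid's/Hilbert's axioms of plane geometry) with perpendicular $x$- and $y$-axes meeting at the origin $(0,0)$ and a common unit length on both axes. A line is regarded as parallel to itself. Geometric product: for real numbers $a$ and $b$, lay $a$ along the $y$-axis and $b$ along the $x$-axis; $ab$ ("$a$ multiplied by $b$") is defined to be the $x$-intercept of the line through the point $(0,a)$ that is parallel to the segment joining $(b,0)$ and $(0,1)$. Every product in the claim is meant in this sense; no other notion of multiplication is presupposed. *)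

theory Defs
  imports "HOL-Analysis.Analysis" "HOL-Library.Multiset"
begin

type_synonym point = "real \<times> real"

definition is_line :: "point set \<Rightarrow> bool" where
  "is_line L \<longleftrightarrow> (\<exists>P Q. P \<noteq> Q \<and> L = affine hull {P, Q})"

text \<open>A line counts as parallel to itself.\<close>

definition parallel_lines :: "point set \<Rightarrow> point set \<Rightarrow> bool" where
  "parallel_lines L M \<longleftrightarrow> is_line L \<and> is_line M \<and> (L = M \<or> L \<inter> M = {})"

text \<open>The first factor \<open>a\<close> is laid along the y-axis and the second factor \<open>b\<close> along the
  x-axis; the product is read off on the x-axis. The description is well defined for all real
  \<open>a\<close> and \<open>b\<close>, including \<open>b = 0\<close>, because the line through \<open>(b, 0)\<close> and \<open>(0, 1)\<close> is never
  horizontal.\<close>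

definition geom_prod :: "real \<Rightarrow> real \<Rightarrow> real" (infixl "\<odot>" 70) where
  "a \<odot> b = (THE x. \<exists>L. parallel_lines L (affine hull {(b, 0), (0, 1)})
                       \<and> (0, a) \<in> L \<and> (x, 0) \<in> L)"

definition is_triangle :: "point \<Rightarrow> point \<Rightarrow> point \<Rightarrow> bool" where
  "is_triangle A B C \<longleftrightarrow> \<not> collinear {A, B, C}"

text \<open>The unoriented angle at the middle argument, a value between \<open>0\<close> and \<open>pi\<close>.\<close>

definition angle :: "point \<Rightarrow> point \<Rightarrow> point \<Rightarrow> real" where
  "angle P Q R = arccos (((P - Q) \<bullet> (R - Q)) / (norm (P - Q) * norm (R - Q)))"

text \<open>Sides and angles are collected in multisets, so that nothing depends on how the
  vertices are labelled while repeated values are still counted.\<close>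

definition side_lengths :: "point \<Rightarrow> point \<Rightarrow> point \<Rightarrow> real multiset" where
  "side_lengths A B C = {#dist B C, dist C A, dist A B#}"

definition angles :: "point \<Rightarrow> point \<Rightarrow> point \<Rightarrow> real multiset" where
  "angles A B C = {#angle C A B, angle A B C, angle B C A#}"

definition similar_triangles ::
    "point \<Rightarrow> point \<Rightarrow> point \<Rightarrow> point \<Rightarrow> point \<Rightarrow> point \<Rightarrow> bool" where
  "similar_triangles A B C A' B' C' \<longleftrightarrow> angles A B C = angles A' B' C'"

end

theory Submission
  imports Defs
begin

text \<open>
  In coordinates the line through \<open>(b, 0)\<close> and \<open>(0, 1)\<close> is \<open>x + b y = b\<close>, and its parallels are
  the other level sets of \<open>x + b y\<close>. The one through \<open>(0, a)\<close> is \<open>x + b y = a b\<close>, which meets the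
  x-axis at \<open>a b\<close>. So the geometric product is the ordinary product (\<open>geom_prod_eq_mult\<close>), and
  the theorem becomes the usual similarity criterion.

  The side lengths and the angles of a triangle determine each other, up to scale, by the laws of
  cosines and of sines. Both laws can be stated so that every side is treated by one and the same
  function, and they then become statements about images of multisets in which the labelling
  of the vertices disappears. By the law of cosines the multiset of angles is the image of the
  multiset of sides under a map that depends only on this multiset and does not change when all
  sides are rescaled (\<open>angles_eq_image_side_lengths\<close>, \<open>opposite_angle_scale\<close>); proportional
  sides therefore give equal angles. By the law of sines the multiset of sides is the image of the
  multiset of angles under \<open>\<theta> \<mapsto> D sin \<theta>\<close>, with \<open>D > 0\<close> the diameter of the circumscribed circle
  (\<open>side_lengths_eq_image_angles\<close>). Two triangles with equal angles thus have side multisets that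
  differ by the factor \<open>D / D\<^sub>1\<close>, and since scaling by a positive factor preserves the order of the
  sides, the sorted side lengths are proportional term by term.
\<close>

section \<open>The geometric product is multiplication\<close>

text \<open>A linear form that is not constant on a line takes every value there, so a line that
  misses a level set of the form (or is that level set) lies in a single level set.\<close>

lemma line_parallel_to_level_set:
  fixes f :: "point \<Rightarrow> real"
  assumes "linear f" and "is_line L"
    and par: "L = {p. f p = c} \<or> L \<inter> {p. f p = c} = {}"
    and "p \<in> L" and "q \<in> L"
  shows "f p = f q"
proof (rule ccontr)
  assume neq: "f p \<noteq> f q"
  define t where "t = (c - f p) / (f q - f p)"
  define r where "r = (1 - t) *\<^sub>R p + t *\<^sub>R q"
  have "affine L"
    using \<open>is_line L\<close> unfolding is_line_def by (auto simp: affine_affine_hull)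
  then have "r \<in> L"
    unfolding r_def using \<open>p \<in> L\<close> \<open>q \<in> L\<close> mem_affine[of L p q "1 - t" t] by simp
  have "f r = f p + t * (f q - f p)"
    unfolding r_def by (simp add: linear_add[OF \<open>linear f\<close>] linear_scale[OF \<open>linear f\<close>])
      (simp add: algebra_simps)
  then have "f r = c"
    using neq by (simp add: t_def)
  with \<open>r \<in> L\<close> par have "L = {p. f p = c}"
    by auto
  with \<open>p \<in> L\<close> \<open>q \<in> L\<close> neq show False
    by auto
qed

lemma level_set_eq_affine_hull:
  fixes b c :: real
  shows "{p :: point. fst p + b * snd p = c} = affine hull {(c, 0), (c - b, 1)}"
proof -
  have "\<exists>u. p = (c, 0) + u *\<^sub>R ((c - b, 1) - (c, 0))"
    if "fst p + b * snd p = c" for p :: point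
    using that by (intro exI[of _ "snd p"]) (auto simp: prod_eq_iff algebra_simps)
  then show ?thesis
    by (auto simp: affine_hull_2_alt algebra_simps)
qed

lemma geom_prod_eq_mult: "a \<odot> b = a * b"
proof -
  let ?f = "\<lambda>p :: point. fst p + b * snd p"
  let ?M = "affine hull {(b, 0), (0, 1)} :: point set"
  have lin: "linear ?f"
    by (rule linearI) (auto simp: algebra_simps)
  have M: "?M = {p. ?f p = b}"
    by (simp add: level_set_eq_affine_hull)
  have line: "is_line {p. ?f p = c}" for c
    unfolding is_line_def level_set_eq_affine_hull by (metis prod.inject zero_neq_one)
  show ?thesis
    unfolding geom_prod_def
  proof (rule the_equality)
    have "parallel_lines {p. ?f p = a * b} ?M"
      unfolding parallel_lines_def M using line by auto
    then show "\<exists>L. parallel_lines L ?M \<and> (0, a) \<in> L \<and> (a * b, 0) \<in> L"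
      by (intro exI[of _ "{p. ?f p = a * b}"]) (simp add: mult.commute)
  next
    fix x
    assume "\<exists>L. parallel_lines L ?M \<and> (0, a) \<in> L \<and> (x, 0) \<in> L"
    then obtain L where "parallel_lines L ?M" and on: "(0, a) \<in> L" "(x, 0) \<in> L"
      by blast
    then have "is_line L" "L = {p. ?f p = b} \<or> L \<inter> {p. ?f p = b} = {}"
      unfolding parallel_lines_def M by auto
    from line_parallel_to_level_set[OF lin this on] show "x = a * b"
      by (simp add: mult.commute)
  qed
qed

section \<open>Angles from sides: the law of cosines\<close>

lemma triangle_distinct:
  assumes "is_triangle A B C"
  shows "A \<noteq> B" and "B \<noteq> C" and "C \<noteq> A"
  using assms unfolding is_triangle_def by (auto simp: insert_commute)

lemma angle_eq_arccos_dist: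
  "angle P Q R =
    arccos (((dist P Q)\<^sup>2 + (dist R Q)\<^sup>2 - (dist P R)\<^sup>2) / (2 * dist P Q * dist R Q))"
  unfolding angle_def by (simp add: dot_norm_neg dist_norm mult.assoc)

text \<open>The law of cosines gives the cosine opposite \<open>x\<close>, in a triangle with further sides \<open>y\<close>
  and \<open>z\<close>, as \<open>(y\<^sup>2 + z\<^sup>2 - x\<^sup>2) / (2 y z)\<close>. Expanding this fraction by \<open>x\<close> makes it depend only on
  \<open>x\<close> and on the symmetric quantities \<open>x\<^sup>2 + y\<^sup>2 + z\<^sup>2\<close> and \<open>x y z\<close>, so that one function of the
  multiset \<open>M\<close> of sides serves all three of them.\<close>

definition opposite_angle :: "real multiset \<Rightarrow> real \<Rightarrow> real" where
  "opposite_angle M x =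
    arccos (((\<Sum>y\<in>#M. y\<^sup>2) - 2 * x\<^sup>2) * x / (2 * prod_mset M))"

lemma opposite_angle_triple:
  assumes "x \<noteq> 0"
  shows "opposite_angle {#x, y, z#} x = arccos ((y\<^sup>2 + z\<^sup>2 - x\<^sup>2) / (2 * y * z))"
proof -
  have "((y\<^sup>2 + z\<^sup>2 - x\<^sup>2) * x) / ((2 * y * z) * x) = (y\<^sup>2 + z\<^sup>2 - x\<^sup>2) / (2 * y * z)"
    using assms by simp
  then show ?thesis
    unfolding opposite_angle_def by (simp add: algebra_simps)
qed

lemma angles_eq_image_side_lengths:
  assumes "is_triangle A B C"
  shows "angles A B C =
    image_mset (opposite_angle (side_lengths A B C)) (side_lengths A B C)"
proof -
  have "angle R P Q = opposite_angle {#dist Q R, dist R P, dist P Q#} (dist Q R)"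
    if "Q \<noteq> R" for P Q R
    using that
    by (simp add: opposite_angle_triple angle_eq_arccos_dist dist_commute)
  from this[of B C A] this[of C A B] this[of A B C] triangle_distinct[OF assms]
  show ?thesis
    by (simp add: angles_def side_lengths_def add_mset_commute)
qed

text \<open>The denominator is a product of three sides, so numerator and denominator are homogeneous
  of the same degree.\<close>

lemma opposite_angle_scale:
  assumes "k \<noteq> 0" and "size M = 3"
  shows "opposite_angle (image_mset (\<lambda>x. k * x) M) (k * x) = opposite_angle M x"
proof -
  have "(\<Sum>y\<in>#image_mset (\<lambda>x. k * x) M. y\<^sup>2) = k\<^sup>2 * (\<Sum>y\<in>#M. y\<^sup>2)"
    by (induction M) (simp_all add: power_mult_distrib algebra_simps)
  then have num: "((\<Sum>y\<in>#image_mset (\<lambda>x. k * x) M. y\<^sup>2) - 2 * (k * x)\<^sup>2) * (k * x) =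
      k ^ 3 * (((\<Sum>y\<in>#M. y\<^sup>2) - 2 * x\<^sup>2) * x)"
    by (simp only:) (simp add: algebra_simps power2_eq_square power3_eq_cube)
  have "prod_mset (image_mset (\<lambda>x. k * x) M) = k ^ size M * prod_mset M"
    by (induction M) simp_all
  then have den: "2 * prod_mset (image_mset (\<lambda>x. k * x) M) = k ^ 3 * (2 * prod_mset M)"
    using \<open>size M = 3\<close> by simp
  show ?thesis
    unfolding opposite_angle_def num den using \<open>k \<noteq> 0\<close> by simp
qed

section \<open>Sides from angles: the law of sines\<close>

definition cross :: "point \<Rightarrow> point \<Rightarrow> real" where
  "cross u v = fst u * snd v - snd u * fst v"

lemma lagrange_identity: "(cross u v)\<^sup>2 + (u \<bullet> v)\<^sup>2 = (norm u)\<^sup>2 * (norm v)\<^sup>2"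
  unfolding power2_norm_eq_inner
  by (simp add: cross_def inner_prod_def power2_eq_square algebra_simps)

text \<open>The vanishing of the cross product is the equality case of the Cauchy--Schwarz
  inequality.\<close>

lemma cross_nonzero_if_triangle:
  assumes "is_triangle A B C"
  shows "cross (B - A) (C - A) \<noteq> 0"
proof
  assume "cross (B - A) (C - A) = 0"
  then have "((B - A) \<bullet> (C - A))\<^sup>2 = (norm (B - A) * norm (C - A))\<^sup>2"
    using lagrange_identity[of "B - A" "C - A"] by (simp add: power_mult_distrib)
  then have "\<bar>(B - A) \<bullet> (C - A)\<bar> = norm (B - A) * norm (C - A)"
    by (intro power2_eq_imp_eq[of "\<bar>(B - A) \<bullet> (C - A)\<bar>"]) simp_all
  then have "collinear {0, B - A, C - A}"
    by (simp add: norm_cauchy_schwarz_equal)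
  then have "collinear {B, A, C}"
    by (subst collinear_3) simp
  then show False
    using assms by (simp add: is_triangle_def insert_commute)
qed

lemma sin_angle:
  assumes "P \<noteq> Q" and "R \<noteq> Q"
  shows "sin (angle P Q R) = \<bar>cross (P - Q) (R - Q)\<bar> / (dist P Q * dist R Q)"
proof -
  let ?u = "P - Q" and ?v = "R - Q"
  let ?n = "norm ?u * norm ?v"
  have n: "?n > 0"
    using assms by simp
  have "\<bar>?u \<bullet> ?v\<bar> \<le> ?n"
    by (rule Cauchy_Schwarz_ineq2)
  then have "\<bar>?u \<bullet> ?v / ?n\<bar> \<le> 1"
    using n by (simp add: abs_mult)
  then have "sin (angle P Q R) = sqrt (1 - (?u \<bullet> ?v / ?n)\<^sup>2)"
    unfolding angle_def by (intro sin_arccos_abs)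
  also have "1 - (?u \<bullet> ?v / ?n)\<^sup>2 = (?n\<^sup>2 - (?u \<bullet> ?v)\<^sup>2) / ?n\<^sup>2"
    using assms by (simp add: power_divide diff_divide_distrib)
  also have "?n\<^sup>2 - (?u \<bullet> ?v)\<^sup>2 = (cross ?u ?v)\<^sup>2"
    using lagrange_identity[of ?u ?v] by (simp add: power_mult_distrib)
  also have "(cross ?u ?v)\<^sup>2 / ?n\<^sup>2 = (cross ?u ?v / ?n)\<^sup>2"
    by (simp add: power_divide)
  also have "sqrt \<dots> = \<bar>cross ?u ?v\<bar> / ?n"
    using n by (simp add: abs_mult)
  finally show ?thesis
    by (simp add: dist_norm)
qed

text \<open>All three sines have the same numerator, because the cross product of two edge vectors is up
  to sign twice the area, whichever vertex they start from. The denominator is the product of the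
  two sides at the vertex, so the ratio of a side to the sine of the opposite angle is in all cases
  the product of the three sides divided by twice the area.\<close>

lemma side_lengths_eq_image_angles:
  assumes "is_triangle A B C"
  obtains D where "D > 0"
    and "side_lengths A B C = image_mset (\<lambda>\<theta>. D * sin \<theta>) (angles A B C)"
proof
  let ?d = "\<bar>cross (B - A) (C - A)\<bar>"
  let ?D = "dist B C * dist C A * dist A B / ?d"
  note distinct = triangle_distinct[OF assms]
  have d: "?d > 0"
    using cross_nonzero_if_triangle[OF assms] by simp
  then show "?D > 0"
    using distinct by simp
  have area: "\<bar>cross (C - A) (B - A)\<bar> = ?d" "\<bar>cross (A - B) (C - B)\<bar> = ?d"
    "\<bar>cross (B - C) (A - C)\<bar> = ?d"
    by (simp_all add: cross_def algebra_simps)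
  have "?D * sin (angle C A B) = dist B C" "?D * sin (angle A B C) = dist C A"
    "?D * sin (angle B C A) = dist A B"
    using distinct distinct[symmetric] d
    by (simp_all add: sin_angle area dist_commute)
  then show "side_lengths A B C = image_mset (\<lambda>\<theta>. ?D * sin \<theta>) (angles A B C)"
    by (simp add: side_lengths_def angles_def)
qed

section \<open>The similarity criterion\<close>

lemma sorted_triple_eq:
  fixes a b c x y z :: real
  assumes "{#a, b, c#} = {#x, y, z#}" and "a \<le> b" "b \<le> c" and "x \<le> y" "y \<le> z"
  shows "a = x \<and> b = y \<and> c = z"
proof -
  have mset: "mset [a, b, c] = mset [x, y, z]" and "sorted [a, b, c]" "sorted [x, y, z]"
    using assms by simp_all
  then have "[a, b, c] = [x, y, z]"
    using properties_for_sort[OF mset] by (simp add: sorted_sort_id)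
  then show ?thesis
    by simp
qed

lemma similar_iff_side_lengths_scaled:
  assumes T: "is_triangle A B C" and T': "is_triangle A' B' C'"
  shows "similar_triangles A' B' C' A B C \<longleftrightarrow>
    (\<exists>k>0. side_lengths A B C = image_mset (\<lambda>x. k * x) (side_lengths A' B' C'))"
proof
  assume sim: "similar_triangles A' B' C' A B C"
  obtain D where D: "D > 0" "side_lengths A B C = image_mset (\<lambda>\<theta>. D * sin \<theta>) (angles A B C)"
    using side_lengths_eq_image_angles[OF T] .
  obtain D' where D': "D' > 0"
    "side_lengths A' B' C' = image_mset (\<lambda>\<theta>. D' * sin \<theta>) (angles A' B' C')"
    using side_lengths_eq_image_angles[OF T'] .
  have "side_lengths A B C = image_mset (\<lambda>x. D / D' * x) (side_lengths A' B' C')"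
    using D D' sim by (simp add: similar_triangles_def multiset.map_comp comp_def)
  then show "\<exists>k>0. side_lengths A B C = image_mset (\<lambda>x. k * x) (side_lengths A' B' C')"
    using D(1) D'(1) by (intro exI[of _ "D / D'"]) simp
next
  assume "\<exists>k>0. side_lengths A B C = image_mset (\<lambda>x. k * x) (side_lengths A' B' C')"
  then obtain k where k: "k > 0"
    "side_lengths A B C = image_mset (\<lambda>x. k * x) (side_lengths A' B' C')"
    by blast
  have "size (side_lengths A' B' C') = 3"
    by (simp add: side_lengths_def)
  then show "similar_triangles A' B' C' A B C"
    using k unfolding similar_triangles_def angles_eq_image_side_lengths[OF T]
      angles_eq_image_side_lengths[OF T']
    by (simp add: multiset.map_comp comp_def opposite_angle_scale)
qed

theorem theorem11:
  fixes A B C A\<^sub>1 B\<^sub>1 C\<^sub>1 :: point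
    and a b c a\<^sub>1 b\<^sub>1 c\<^sub>1 :: real
  assumes "is_triangle A B C"
    and "side_lengths A B C = {#a, b, c#}" and "a \<le> b" and "b \<le> c"
    and "is_triangle A\<^sub>1 B\<^sub>1 C\<^sub>1"
    and "side_lengths A\<^sub>1 B\<^sub>1 C\<^sub>1 = {#a\<^sub>1, b\<^sub>1, c\<^sub>1#}" and "a\<^sub>1 \<le> b\<^sub>1" and "b\<^sub>1 \<le> c\<^sub>1"
  shows "similar_triangles A\<^sub>1 B\<^sub>1 C\<^sub>1 A B C \<longleftrightarrow>
    (\<exists>k>0. a = k \<odot> a\<^sub>1 \<and> b = k \<odot> b\<^sub>1 \<and> c = k \<odot> c\<^sub>1)"
proof -
  have "similar_triangles A\<^sub>1 B\<^sub>1 C\<^sub>1 A B C \<longleftrightarrow>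
      (\<exists>k>0. {#a, b, c#} = {#k * a\<^sub>1, k * b\<^sub>1, k * c\<^sub>1#})"
    using similar_iff_side_lengths_scaled[OF assms(1,5)] assms(2,6) by simp
  also have "\<dots> \<longleftrightarrow> (\<exists>k>0. a = k * a\<^sub>1 \<and> b = k * b\<^sub>1 \<and> c = k * c\<^sub>1)"
  proof -
    have "a = k * a\<^sub>1 \<and> b = k * b\<^sub>1 \<and> c = k * c\<^sub>1"
      if "k > 0" and "{#a, b, c#} = {#k * a\<^sub>1, k * b\<^sub>1, k * c\<^sub>1#}" for k
      using that assms(3,4,7,8) by (intro sorted_triple_eq) simp_all
    then show ?thesis
      by blast
  qed
  finally show ?thesis
    by (simp add: geom_prod_eq_mult)
qed

end
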